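(* Let $k\ge 1$ and let $T=T(a_1,\ldots,a_k)$ be a caterpillar tree with $a_i\ge 1$ for all $i$. Then the domination polynomial $D(T;x)=\sum_{j\ge 0}d_j(T)x^j$ is equal to \[ D(T;x)=\prod_{i=1}^{k}\bigl(x^{a_i}+x(1+x)^{a_i}\bigr), \] and its coefficients form a log-concave sequence, i.e. $d_j(T)^2\ge d_{j-1}(T)\,d_{j+1}(T)$ for all $j\ge 1$.
   Context: The caterpillar tree $T(a_1,\ldots,a_k)$ consists of a spine of vertices $v_1,\ldots,v_k$ with edges $v_iv_{i+1}$ for $1\le i\le k-1$, and, for each $i$, $a_i$ leaves attached to $v_i$. A dominating set of a finite graph $G$ is a set $S$ of vertices such that every vertex of $G$ is in $S$ or adjacent to a vertex of $S$; $d_j(G)$ is the number of dominating sets of $G$ of cardinality $j$. *)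

theory Defs
  imports "Graph_Theory.Graph_Theory" "HOL-Computational_Algebra.Polynomial"
begin

text \<open>
  As usual in the library, an undirected simple graph is a symmetric loop-free digraph
  (locales \<open>graph\<close> and \<open>pair_graph\<close>). The notions below are meant for finite graphs.
\<close>

definition dominating_set :: "('a, 'b) pre_digraph \<Rightarrow> 'a set \<Rightarrow> bool" where
  "dominating_set G S \<longleftrightarrow>
     S \<subseteq> verts G \<and> (\<forall>v\<in>verts G. v \<in> S \<or> (\<exists>u\<in>S. u \<rightarrow>\<^bsub>G\<^esub> v))"

definition num_dominating_sets :: "('a, 'b) pre_digraph \<Rightarrow> nat \<Rightarrow> nat" where
  "num_dominating_sets G j = card {S. dominating_set G S \<and> card S = j}"

text \<open>
  The sum stops at the number of vertices, beyond which there are no dominating sets;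
  see \<open>coeff_domination_poly\<close>.
\<close>
definition domination_poly :: "('a, 'b) pre_digraph \<Rightarrow> int poly" where
  "domination_poly G = (\<Sum>j\<le>card (verts G). monom (int (num_dominating_sets G j)) j)"

lemma coeff_domination_poly:
  assumes "finite (verts G)"
  shows "coeff (domination_poly G) j = int (num_dominating_sets G j)"
proof (cases "j \<le> card (verts G)")
  case True
  then show ?thesis by (simp add: domination_poly_def coeff_sum)
next
  case False
  then have none: "{S. dominating_set G S \<and> card S = j} = {}"
    using assms card_mono by (fastforce simp: dominating_set_def)
  show ?thesis
    unfolding domination_poly_def num_dominating_sets_def none
    using False by (simp add: coeff_sum)
qed

text \<open>\<open>Spine i\<close> is the spine vertex $v_i$, and \<open>Leaf i j\<close> is the $j$-th leaf attached to it.\<close>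

datatype cat_vertex = Spine nat | Leaf nat nat

definition caterpillar_verts :: "nat \<Rightarrow> (nat \<Rightarrow> nat) \<Rightarrow> cat_vertex set" where
  "caterpillar_verts k a =
     {Spine i |i. i \<in> {1..k}} \<union> {Leaf i j |i j. i \<in> {1..k} \<and> j \<in> {1..a i}}"

definition caterpillar_edges :: "nat \<Rightarrow> (nat \<Rightarrow> nat) \<Rightarrow> cat_vertex rel" where
  "caterpillar_edges k a =
     {(Spine i, Spine (i + 1)) |i. 1 \<le> i \<and> i + 1 \<le> k} \<union>
     {(Spine i, Leaf i j) |i j. i \<in> {1..k} \<and> j \<in> {1..a i}}"

text \<open>\<open>caterpillar k a\<close> is $T(a_1,\ldots,a_k)$; only the values of \<open>a\<close> on \<open>{1..k}\<close> matter.\<close>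

definition caterpillar :: "nat \<Rightarrow> (nat \<Rightarrow> nat) \<Rightarrow> cat_vertex pair_pre_digraph" where
  "caterpillar k a =
     \<lparr> pverts = caterpillar_verts k a,
       parcs = caterpillar_edges k a \<union> (caterpillar_edges k a)\<inverse> \<rparr>"

lemma finite_caterpillar_verts: "finite (caterpillar_verts k a)"
proof -
  have "caterpillar_verts k a =
      Spine ` {1..k} \<union> (\<lambda>(i, j). Leaf i j) ` (SIGMA i:{1..k}. {1..a i})"
    by (auto simp: caterpillar_verts_def)
  then show ?thesis by simp
qed

lemma pair_graph_caterpillar: "pair_graph (caterpillar k a)"
proof -
  have sub: "parcs (caterpillar k a) \<subseteq> caterpillar_verts k a \<times> caterpillar_verts k a"
    by (auto simp: caterpillar_def caterpillar_edges_def caterpillar_verts_def)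
  have fin: "finite (parcs (caterpillar k a))"
    by (rule finite_subset[OF sub]) (simp add: finite_caterpillar_verts)
  have sym: "symmetric (with_proj (caterpillar k a))"
    by (auto simp: symmetric_def caterpillar_def sym_Un_converse)
  have loop: "fst e \<noteq> snd e" if "e \<in> parcs (caterpillar k a)" for e
    using that by (auto simp: caterpillar_def caterpillar_edges_def)
  show ?thesis
    using sub fin sym loop
    by unfold_locales
      (auto simp: caterpillar_def finite_caterpillar_verts)
qed

end

theory Submission
  imports Defs
begin

text \<open>
  \<^emph>\<open>The product formula.\<close> Group each spine vertex with its leaves into a block. A leaf can only
  be dominated by itself or by its spine vertex, so a dominating set contains, in every block, the
  spine vertex or all the leaves. Conversely this suffices: a spine vertex outside the set has
  all its leaves in the set, and it has at least one leaf. The condition does not involve the edges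
  between spine vertices (\<open>dominating_set_caterpillar_iff\<close>), so the blocks can be filled
  independently and the generating function is a product (\<open>sum_blockwise_monom_card\<close>). A block
  with $a$ leaves contributes $x(1+x)^a$ for the sets that contain the spine vertex and $x^a$ for
  the set of all leaves.

  \<^emph>\<open>Log-concavity.\<close> Multiplication of polynomials is multiplication of their lower triangular
  Toeplitz matrices $(p_{r-c})_{r,c}$. If all $2 \times 2$ minors of two matrices are nonnegative,
  then so are those of their product, by the Cauchy--Binet formula (\<open>nonneg_minors2_mult\<close>).
  Nonnegative minors of a Toeplitz matrix include
  $p_j^2 - p_{j-1}p_{j+1}$, so they imply log-concavity, and for a nonnegative sequence without
  internal zeros they follow from it (\<open>nonneg_minors2_toeplitz_if_log_concave\<close>). It
  remains to see that each factor $x^a + x(1+x)^a$ is log-concave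
  (\<open>caterpillar_factor_log_concave\<close>): its coefficients are a shifted row of Pascal's triangle
  with the coefficient of $x^a$ raised by one. Raising an entry can only spoil the inequalities
  centred at its two neighbours, and there the slack in Pascal's triangle is large enough.
\<close>

section \<open>The domination polynomial of a caterpillar\<close>

lemma domination_poly_eq_sum_dominating_sets:
  assumes "finite (verts G)"
  shows "domination_poly G = (\<Sum>S | dominating_set G S. monom 1 (card S))"
proof (rule poly_eqI)
  fix j
  have "finite {S. dominating_set G S}"
    by (rule finite_subset[of _ "Pow (verts G)"]) (auto simp: dominating_set_def assms)
  then have "coeff (\<Sum>S | dominating_set G S. monom 1 (card S)) j =
      int (card ({S. dominating_set G S} \<inter> {S. card S = j}))"
    by (simp add: coeff_sum sum.If_cases)
  also have "{S. dominating_set G S} \<inter> {S. card S = j} = {S. dominating_set G S \<and> card S = j}"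
    by blast
  finally show "coeff (domination_poly G) j =
      coeff (\<Sum>S | dominating_set G S. monom 1 (card S)) j"
    using assms by (simp add: coeff_domination_poly num_dominating_sets_def)
qed

lemma sum_Pow_monom_card:
  assumes "finite A"
  shows "(\<Sum>X\<in>Pow A. monom (1::'a::comm_semiring_1) (card X)) = (1 + [:0, 1:]) ^ card A"
proof -
  have "(1 + [:0, 1:]) ^ card A = (\<Prod>x\<in>A. [:0, 1::'a:] + 1)"
    by (simp add: add.commute)
  also have "\<dots> = (\<Sum>X\<in>Pow A. [:0, 1:] ^ card X)"
    using prod_add[OF assms, of "\<lambda>_. [:0, 1::'a:]" "\<lambda>_. 1"] by simp
  finally show ?thesis by (simp add: monom_altdef)
qed

text \<open>
  A set that is a union of pieces, one in each of the disjoint blocks \<open>B i\<close>, is the same as a choice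
  function for its pieces, and its cardinality is the sum of theirs. Summing $x^{|S|}$ over all
  choices is expanding the product on the right by distributivity.
\<close>
lemma sum_blockwise_monom_card:
  fixes B :: "'i \<Rightarrow> 'v set" and F :: "'i \<Rightarrow> 'v set set"
  assumes "finite I"
    and fin: "\<And>i. i \<in> I \<Longrightarrow> finite (B i)"
    and disj: "disjoint_family_on B I"
    and sub: "\<And>i. i \<in> I \<Longrightarrow> F i \<subseteq> Pow (B i)"
  shows "(\<Sum>S | S \<subseteq> (\<Union>i\<in>I. B i) \<and> (\<forall>i\<in>I. S \<inter> B i \<in> F i). monom (1::'a::comm_semiring_1) (card S)) =
         (\<Prod>i\<in>I. \<Sum>A\<in>F i. monom 1 (card A))"
proof -
  have finF: "finite (F i)" if "i \<in> I" for i
    using sub[OF that] fin[OF that] by (meson finite_Pow_iff finite_subset)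
  have part: "(\<Union>j\<in>I. g j) \<inter> B i = g i" if "g \<in> Pi\<^sub>E I F" "i \<in> I" for g i
  proof -
    have "g j \<subseteq> B j" if "j \<in> I" for j
      using \<open>g \<in> _\<close> that sub by (auto simp: PiE_iff)
    then show ?thesis
      using disj \<open>i \<in> I\<close> by (fastforce simp: disjoint_family_on_def)
  qed
  have "(\<Prod>i\<in>I. \<Sum>A\<in>F i. monom (1::'a) (card A)) =
      (\<Sum>g\<in>Pi\<^sub>E I F. \<Prod>i\<in>I. monom 1 (card (g i)))"
    by (rule prod_sum_PiE) (use assms finF in auto)
  also have "\<dots> = (\<Sum>g\<in>Pi\<^sub>E I F. monom 1 (card (\<Union>i\<in>I. g i)))"
  proof (rule sum.cong[OF refl])
    fix g assume g: "g \<in> Pi\<^sub>E I F"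
    then have gB: "g i \<subseteq> B i" if "i \<in> I" for i
      using that sub by (auto simp: PiE_iff)
    have "card (\<Union>i\<in>I. g i) = (\<Sum>i\<in>I. card (g i))"
    proof (rule card_UN_disjoint)
      show "\<forall>i\<in>I. finite (g i)" using gB fin finite_subset by blast
      show "\<forall>i\<in>I. \<forall>j\<in>I. i \<noteq> j \<longrightarrow> g i \<inter> g j = {}"
        using gB disj by (fastforce simp: disjoint_family_on_def)
    qed fact
    then show "(\<Prod>i\<in>I. monom (1::'a) (card (g i))) = monom 1 (card (\<Union>i\<in>I. g i))"
      by (simp add: monom_altdef power_sum)
  qed
  also have "\<dots> = (\<Sum>S | S \<subseteq> (\<Union>i\<in>I. B i) \<and> (\<forall>i\<in>I. S \<inter> B i \<in> F i). monom 1 (card S))"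
  proof (rule sum.reindex_bij_witness[of _ "\<lambda>S. \<lambda>i\<in>I. S \<inter> B i" "\<lambda>g. \<Union>i\<in>I. g i"])
    fix g assume g: "g \<in> Pi\<^sub>E I F"
    show "(\<lambda>i\<in>I. (\<Union>i\<in>I. g i) \<inter> B i) = g"
      using g part[OF g] by (intro ext) (auto simp: PiE_iff extensional_def)
    show "(\<Union>i\<in>I. g i) \<in> {S. S \<subseteq> (\<Union>i\<in>I. B i) \<and> (\<forall>i\<in>I. S \<inter> B i \<in> F i)}"
      using g part[OF g] sub by (fastforce simp: PiE_iff)
  qed auto
  finally show ?thesis ..
qed

definition cat_leaves :: "(nat \<Rightarrow> nat) \<Rightarrow> nat \<Rightarrow> cat_vertex set" where
  "cat_leaves a i = Leaf i ` {1..a i}"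

definition cat_block :: "(nat \<Rightarrow> nat) \<Rightarrow> nat \<Rightarrow> cat_vertex set" where
  "cat_block a i = insert (Spine i) (cat_leaves a i)"

lemma caterpillar_verts_eq_blocks: "caterpillar_verts k a = (\<Union>i\<in>{1..k}. cat_block a i)"
  by (auto simp: caterpillar_verts_def cat_block_def cat_leaves_def)

text \<open>
  The leaves force the right-hand side, having only one neighbour each. For the converse, the
  hypothesis provides a leaf next to every spine vertex, so that having all the leaves of a block
  dominates its spine vertex too.
\<close>
lemma dominating_set_caterpillar_iff:
  assumes "\<forall>i\<in>{1..k}. a i \<ge> 1"
  shows "dominating_set (caterpillar k a) S \<longleftrightarrow>
    S \<subseteq> caterpillar_verts k a \<and> (\<forall>i\<in>{1..k}. Spine i \<in> S \<or> cat_leaves a i \<subseteq> S)"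
    (is "?L \<longleftrightarrow> ?R")
proof
  assume L: ?L
  have "Spine i \<in> S \<or> cat_leaves a i \<subseteq> S" if i: "i \<in> {1..k}" for i
  proof -
    have "Leaf i j \<in> S \<or> Spine i \<in> S" if "j \<in> {1..a i}" for j
    proof -
      have "Leaf i j \<in> caterpillar_verts k a"
        using i that by (auto simp: caterpillar_verts_def)
      then show ?thesis
        using L by (fastforce simp: dominating_set_def caterpillar_def caterpillar_edges_def)
    qed
    then show ?thesis by (auto simp: cat_leaves_def)
  qed
  then show ?R using L by (simp add: dominating_set_def caterpillar_def)
next
  assume R: ?R
  have "v \<in> S \<or> (\<exists>u\<in>S. u \<rightarrow>\<^bsub>caterpillar k a\<^esub> v)" if v: "v \<in> caterpillar_verts k a" for v
  proof (cases v)
    case (Spine i)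
    then have i: "i \<in> {1..k}" using v by (auto simp: caterpillar_verts_def)
    then have "1 \<in> {1..a i}" using assms by auto
    then have "Leaf i 1 \<in> cat_leaves a i" "Leaf i 1 \<rightarrow>\<^bsub>caterpillar k a\<^esub> v"
      using i Spine by (auto simp: cat_leaves_def caterpillar_def caterpillar_edges_def)
    then show ?thesis using R i Spine by blast
  next
    case (Leaf i j)
    then have i: "i \<in> {1..k}" and j: "j \<in> {1..a i}"
      using v by (auto simp: caterpillar_verts_def)
    then have "Leaf i j \<in> cat_leaves a i" "Spine i \<rightarrow>\<^bsub>caterpillar k a\<^esub> v"
      using Leaf by (auto simp: cat_leaves_def caterpillar_def caterpillar_edges_def)
    then show ?thesis using R i Leaf by blast
  qed
  then show ?L using R by (simp add: dominating_set_def caterpillar_def)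
qed

text \<open>
  The sets of leaves alone and those with the spine vertex are counted separately: only the full set
  of leaves is admissible without the spine vertex, and with it every subset of the leaves is.
\<close>
lemma sum_block_monom_card:
  "(\<Sum>A | A \<subseteq> cat_block a i \<and> (Spine i \<in> A \<or> cat_leaves a i \<subseteq> A). monom (1::'a::comm_semiring_1) (card A)) =
   [:0, 1:] ^ a i + [:0, 1:] * (1 + [:0, 1:]) ^ a i"
proof -
  let ?L = "cat_leaves a i"
  have L: "finite ?L" "card ?L = a i" "Spine i \<notin> ?L"
    by (auto simp: cat_leaves_def card_image inj_on_def)
  have split: "{A. A \<subseteq> cat_block a i \<and> (Spine i \<in> A \<or> ?L \<subseteq> A)} =
      insert ?L (insert (Spine i) ` Pow ?L)"
  proof (intro equalityI subsetI)
    fix A assume A: "A \<in> {A. A \<subseteq> cat_block a i \<and> (Spine i \<in> A \<or> ?L \<subseteq> A)}"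
    show "A \<in> insert ?L (insert (Spine i) ` Pow ?L)"
    proof (cases "Spine i \<in> A")
      case True
      then have "A = insert (Spine i) (A - {Spine i})" "A - {Spine i} \<subseteq> ?L"
        using A by (auto simp: cat_block_def)
      then show ?thesis by blast
    qed (use A in \<open>auto simp: cat_block_def\<close>)
  qed (auto simp: cat_block_def)
  have "(\<Sum>A\<in>insert (Spine i) ` Pow ?L. monom (1::'a) (card A)) =
      (\<Sum>A\<in>Pow ?L. monom 1 (card (insert (Spine i) A)))"
  proof (rule sum.reindex_cong[OF _ refl refl])
    show "inj_on (insert (Spine i)) (Pow ?L)"
      using L(3) by (meson PowD inj_onI insert_ident subsetD)
  qed
  also have "\<dots> = (\<Sum>A\<in>Pow ?L. [:0, 1:] * monom 1 (card A))"
  proof (rule sum.cong[OF refl])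
    fix A assume "A \<in> Pow ?L"
    then have "finite A" "Spine i \<notin> A" using L finite_subset by auto
    then show "monom (1::'a) (card (insert (Spine i) A)) = [:0, 1:] * monom 1 (card A)"
      by (simp add: monom_altdef)
  qed
  also have "\<dots> = [:0, 1:] * (1 + [:0, 1:]) ^ a i"
    using sum_Pow_monom_card[OF L(1), where ?'a = 'a] L(2) by (simp only: sum_distrib_left[symmetric])
  finally show ?thesis
    using L unfolding split
    by (subst sum.insert) (auto simp: monom_altdef)
qed

lemma domination_poly_caterpillar:
  assumes "\<forall>i\<in>{1..k}. a i \<ge> 1"
  shows "domination_poly (caterpillar k a) =
    (\<Prod>i=1..k. [:0, 1:] ^ a i + [:0, 1:] * (1 + [:0, 1:]) ^ a i)"
proof -
  let ?F = "\<lambda>i. {A. A \<subseteq> cat_block a i \<and> (Spine i \<in> A \<or> cat_leaves a i \<subseteq> A)}"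
  have fin: "finite (verts (caterpillar k a))"
    by (simp add: caterpillar_def finite_caterpillar_verts)
  have "{S. dominating_set (caterpillar k a) S} =
      {S. S \<subseteq> (\<Union>i\<in>{1..k}. cat_block a i) \<and> (\<forall>i\<in>{1..k}. S \<inter> cat_block a i \<in> ?F i)}"
    unfolding dominating_set_caterpillar_iff[OF assms] caterpillar_verts_eq_blocks
    by (auto simp: cat_block_def)
  then have "domination_poly (caterpillar k a) =
      (\<Sum>S | S \<subseteq> (\<Union>i\<in>{1..k}. cat_block a i) \<and> (\<forall>i\<in>{1..k}. S \<inter> cat_block a i \<in> ?F i). monom 1 (card S))"
    using domination_poly_eq_sum_dominating_sets[OF fin] by simp
  also have "\<dots> = (\<Prod>i\<in>{1..k}. \<Sum>A\<in>?F i. monom 1 (card A))"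
    by (rule sum_blockwise_monom_card)
      (auto simp: cat_block_def cat_leaves_def disjoint_family_on_def)
  finally show ?thesis by (simp only: sum_block_monom_card)
qed

section \<open>Log-concavity as total positivity of order two\<close>

text \<open>
  Rows and columns are indexed by all natural numbers, so that Toeplitz matrices of polynomials of
  any degree fit. For nonnegative entries this is total positivity of order two.
\<close>
definition nonneg_minors2 :: "(nat \<Rightarrow> nat \<Rightarrow> 'a::linordered_idom) \<Rightarrow> bool" where
  "nonneg_minors2 F \<longleftrightarrow>
     (\<forall>r r' c c'. r < r' \<longrightarrow> c < c' \<longrightarrow> F r c' * F r' c \<le> F r c * F r' c')"

text \<open>
  This is the Cauchy--Binet formula for $2 \times 2$ minors. To avoid summing over increasing pairs
  of indices, all ordered pairs are used, which counts every product of minors twice; swapping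
  the two indices changes the sign of both minors, so each product is nonnegative in either order.
\<close>
lemma nonneg_minors2_mult:
  fixes F G :: "nat \<Rightarrow> nat \<Rightarrow> 'a::linordered_idom"
  assumes F: "nonneg_minors2 F" and G: "nonneg_minors2 G"
  shows "nonneg_minors2 (\<lambda>r c. \<Sum>l\<in>L. F r l * G l c)"
  unfolding nonneg_minors2_def
proof (intro allI impI)
  fix r r' c c' :: nat
  assume r: "r < r'" and c: "c < c'"
  let ?H = "\<lambda>r c. \<Sum>l\<in>L. F r l * G l c"
  let ?f = "\<lambda>l m. F r l * F r' m - F r m * F r' l"
  let ?g = "\<lambda>l m. G l c * G m c' - G l c' * G m c"
  have minor: "?H r c * ?H r' c' - ?H r c' * ?H r' c =
      (\<Sum>l\<in>L. \<Sum>m\<in>L. F r l * F r' m * ?g l m)"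
    unfolding sum_product sum_subtractf[symmetric] by (simp add: algebra_simps)
  also have "\<dots> = (\<Sum>l\<in>L. \<Sum>m\<in>L. F r m * F r' l * ?g m l)"
    by (rule sum.swap)
  finally have minor': "?H r c * ?H r' c' - ?H r c' * ?H r' c =
      (\<Sum>l\<in>L. \<Sum>m\<in>L. F r m * F r' l * ?g m l)" .
  have "(\<Sum>l\<in>L. \<Sum>m\<in>L. ?f l m * ?g l m) =
      (\<Sum>l\<in>L. \<Sum>m\<in>L. F r l * F r' m * ?g l m) + (\<Sum>l\<in>L. \<Sum>m\<in>L. F r m * F r' l * ?g m l)"
    by (simp add: sum.distrib[symmetric] algebra_simps)
  then have "(\<Sum>l\<in>L. \<Sum>m\<in>L. ?f l m * ?g l m) = 2 * (?H r c * ?H r' c' - ?H r c' * ?H r' c)"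
    unfolding minor[symmetric] minor'[symmetric] by simp
  moreover have "0 \<le> ?f l m * ?g l m" for l m
  proof (cases l m rule: linorder_cases)
    case less
    then have "F r m * F r' l \<le> F r l * F r' m" "G l c' * G m c \<le> G l c * G m c'"
      using F G r c unfolding nonneg_minors2_def by blast+
    then have "0 \<le> ?f l m" "0 \<le> ?g l m"
      by auto
    then show ?thesis by (rule mult_nonneg_nonneg)
  next
    case greater
    then have "F r l * F r' m \<le> F r m * F r' l" "G m c' * G l c \<le> G m c * G l c'"
      using F G r c unfolding nonneg_minors2_def by blast+
    then have "?f l m \<le> 0" "?g l m \<le> 0"
      by (auto simp: algebra_simps)
    then show ?thesis by (rule mult_nonpos_nonpos)
  qed simp
  ultimately have "0 \<le> 2 * (?H r c * ?H r' c' - ?H r c' * ?H r' c)"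
    by (metis (no_types, lifting) sum_nonneg)
  then show "?H r c' * ?H r' c \<le> ?H r c * ?H r' c'"
    by (simp add: zero_le_mult_iff)
qed

definition toeplitz :: "'a::zero poly \<Rightarrow> nat \<Rightarrow> nat \<Rightarrow> 'a" where
  "toeplitz p r c = (if c \<le> r then coeff p (r - c) else 0)"

text \<open>
  Both matrices are lower triangular, so row \<open>r\<close> of the infinite product is a finite sum, and
  cutting it off at any \<open>N \<ge> r\<close> gives the same value. The freedom in \<open>N\<close> lets two rows of a minor
  share one range of summation.
\<close>
lemma toeplitz_mult:
  fixes p q :: "'a::comm_semiring_1 poly"
  assumes "r \<le> N"
  shows "(\<Sum>l\<le>N. toeplitz p r l * toeplitz q l c) = toeplitz (p * q) r c"
proof -
  have "(\<Sum>l\<le>N. toeplitz p r l * toeplitz q l c) =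
      (\<Sum>l=c..r. coeff p (r - l) * coeff q (l - c))"
    by (rule sum.mono_neutral_cong_right) (use assms in \<open>auto simp: toeplitz_def\<close>)
  also have "\<dots> = toeplitz (p * q) r c"
  proof (cases "c \<le> r")
    case True
    have "(\<Sum>l=c..r. coeff p (r - l) * coeff q (l - c)) =
        (\<Sum>i\<le>r - c. coeff p i * coeff q (r - c - i))"
      by (rule sum.reindex_bij_witness[of _ "\<lambda>i. r - i" "\<lambda>l. r - l"]) (use True in auto)
    then show ?thesis using True by (simp add: toeplitz_def coeff_mult)
  qed (simp add: toeplitz_def)
  finally show ?thesis .
qed

lemma nonneg_minors2_toeplitz_mult:
  fixes p q :: "'a::linordered_idom poly"
  assumes "nonneg_minors2 (toeplitz p)" "nonneg_minors2 (toeplitz q)"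
  shows "nonneg_minors2 (toeplitz (p * q))"
  unfolding nonneg_minors2_def
proof (intro allI impI)
  fix r r' c c' :: nat
  assume "r < r'" "c < c'"
  then have "(\<Sum>l\<le>r'. toeplitz p r l * toeplitz q l c') * (\<Sum>l\<le>r'. toeplitz p r' l * toeplitz q l c)
      \<le> (\<Sum>l\<le>r'. toeplitz p r l * toeplitz q l c) * (\<Sum>l\<le>r'. toeplitz p r' l * toeplitz q l c')"
    using nonneg_minors2_mult[OF assms, of "{..r'}"] unfolding nonneg_minors2_def by blast
  with \<open>r < r'\<close> show "toeplitz (p * q) r c' * toeplitz (p * q) r' c
      \<le> toeplitz (p * q) r c * toeplitz (p * q) r' c'"
    by (simp add: toeplitz_mult)
qed

lemma nonneg_minors2_toeplitz_prod:
  fixes p :: "'i \<Rightarrow> 'a::linordered_idom poly"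
  assumes "\<And>i. i \<in> I \<Longrightarrow> nonneg_minors2 (toeplitz (p i))"
  shows "nonneg_minors2 (toeplitz (\<Prod>i\<in>I. p i))"
  using assms
proof (induction I rule: infinite_finite_induct)
  case (insert i I)
  then show ?case by (simp add: nonneg_minors2_toeplitz_mult)
qed (auto simp: nonneg_minors2_def toeplitz_def)

text \<open>
  The minor of rows \<open>n + 1\<close>, \<open>n + 2\<close> and columns \<open>0\<close>, \<open>1\<close>.
\<close>
lemma log_concave_if_nonneg_minors2_toeplitz:
  assumes "nonneg_minors2 (toeplitz p)"
  shows "coeff p n * coeff p (n + 2) \<le> (coeff p (n + 1))\<^sup>2"
proof -
  have "toeplitz p (n + 1) 1 * toeplitz p (n + 2) 0 \<le> toeplitz p (n + 1) 0 * toeplitz p (n + 2) 1"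
    using assms unfolding nonneg_minors2_def by simp
  then show ?thesis by (simp add: toeplitz_def power2_eq_square)
qed

text \<open>
  Log-concavity says that the ratio $f(n+1)/f(n)$ is decreasing on the support of $f$; so is
  then $f(n+t)/f(n)$, a product of $t$ such ratios. Division is avoided by cancelling positive
  factors. Without the absence of internal zeros the claim fails, for example for
  $1, 0, 0, 1$, as nothing then links the two parts of the support.
\<close>
lemma log_concave_spread:
  fixes f :: "nat \<Rightarrow> 'a::linordered_idom"
  assumes nonneg: "\<And>n. 0 \<le> f n"
    and no_gaps: "\<And>l m n. l < m \<Longrightarrow> m < n \<Longrightarrow> f l \<noteq> 0 \<Longrightarrow> f n \<noteq> 0 \<Longrightarrow> f m \<noteq> 0"
    and log_concave: "\<And>n. f n * f (n + 2) \<le> (f (n + 1))\<^sup>2"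
  shows "f x * f (x + s + t) \<le> f (x + s) * f (x + t)"
proof -
  \<comment> \<open>The ratio of successive values at \<open>m + d\<close> is at most that at \<open>m\<close>.\<close>
  have step: "f m * f (m + d + 1) \<le> f (m + 1) * f (m + d)" for m d
  proof (induction d)
    case (Suc d)
    let ?n = "m + d"
    show ?case
    proof (cases "f m = 0 \<or> f (?n + 2) = 0")
      case True
      then show ?thesis using nonneg by auto
    next
      case False
      then have pos: "0 < f (?n + 1)"
        using no_gaps[of m "?n + 1" "?n + 2"] nonneg[of "?n + 1"] by (simp add: order.not_eq_order_implies_strict)
      have "f (?n + 1) * (f m * f (?n + 2)) = (f m * f (?n + 1)) * f (?n + 2)"
        by (simp add: algebra_simps)
      also have "\<dots> \<le> (f (m + 1) * f ?n) * f (?n + 2)"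
        by (rule mult_right_mono) (use Suc.IH nonneg in auto)
      also have "\<dots> = f (m + 1) * (f ?n * f (?n + 2))"
        by (simp add: algebra_simps)
      also have "\<dots> \<le> f (m + 1) * (f (?n + 1))\<^sup>2"
        by (rule mult_left_mono) (use log_concave nonneg in auto)
      also have "\<dots> = f (?n + 1) * (f (m + 1) * f (?n + 1))"
        by (simp add: power2_eq_square algebra_simps)
      finally have "f m * f (?n + 2) \<le> f (m + 1) * f (?n + 1)"
        using pos by (simp only: mult_le_cancel_left_pos)
      then show ?thesis by (simp add: add.assoc)
    qed
  qed simp
  show ?thesis
  proof (induction s)
    case (Suc s)
    let ?u = "x + s" and ?v = "x + s + t"
    show ?case
    proof (cases "f x = 0 \<or> f (?v + 1) = 0")
      case True
      then show ?thesis using nonneg by auto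
    next
      case False
      have "f m \<noteq> 0" if "x \<le> m" "m \<le> ?v" for m
        using no_gaps[of x m "?v + 1"] that False by (cases "m = x") auto
      then have pos: "0 < f ?u * f ?v"
        using nonneg by (simp add: order.not_eq_order_implies_strict)
      have "(f ?u * f ?v) * (f x * f (?v + 1)) = (f x * f ?v) * (f ?u * f (?u + t + 1))"
        by (simp add: algebra_simps)
      also have "\<dots> \<le> (f ?u * f (x + t)) * (f (?u + 1) * f (?u + t))"
        by (rule mult_mono) (use Suc.IH step nonneg in auto)
      also have "\<dots> = (f ?u * f ?v) * (f (?u + 1) * f (x + t))"
        by (simp add: algebra_simps)
      finally have "f x * f (?v + 1) \<le> f (?u + 1) * f (x + t)"
        using pos by (simp only: mult_le_cancel_left_pos)
      then show ?thesis by simp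
    qed
  qed simp
qed

text \<open>
  The four indices in a minor are $x$, $x+s$, $x+t$ and $x+s+t$, where $x = r - c'$ is the smallest,
  $s = c' - c$ and $t = r' - r$. If $x$ is negative, the entry at row $r$ and column $c'$ vanishes.
\<close>
lemma nonneg_minors2_toeplitz_if_log_concave:
  fixes p :: "'a::linordered_idom poly"
  assumes "\<And>n. 0 \<le> coeff p n"
    and "\<And>l m n. l < m \<Longrightarrow> m < n \<Longrightarrow> coeff p l \<noteq> 0 \<Longrightarrow> coeff p n \<noteq> 0 \<Longrightarrow> coeff p m \<noteq> 0"
    and "\<And>n. coeff p n * coeff p (n + 2) \<le> (coeff p (n + 1))\<^sup>2"
  shows "nonneg_minors2 (toeplitz p)"
  unfolding nonneg_minors2_def
proof (intro allI impI)
  fix r r' c c' :: nat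
  assume r: "r < r'" and c: "c < c'"
  show "toeplitz p r c' * toeplitz p r' c \<le> toeplitz p r c * toeplitz p r' c'"
  proof (cases "c' \<le> r")
    case True
    have "r - c = (r - c') + (c' - c)" "r' - c' = (r - c') + (r' - r)"
      "r' - c = (r - c') + (c' - c) + (r' - r)"
      using r c True by auto
    then show ?thesis
      using log_concave_spread[of "coeff p" "r - c'" "c' - c" "r' - r", OF assms] r c True
      by (simp add: toeplitz_def)
  next
    case False
    then show ?thesis using assms(1) by (simp add: toeplitz_def)
  qed
qed

section \<open>The factor of a single spine vertex\<close>

lemma coeff_caterpillar_factor:
  "coeff ([:0, 1:] ^ a + [:0, 1:] * (1 + [:0, 1:]) ^ a :: 'a::comm_semiring_1 poly) n =
     (if n = a then 1 else 0) + (case n of 0 \<Rightarrow> 0 | Suc m \<Rightarrow> of_nat (a choose m))"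
proof -
  define q :: "'a poly" where "q = (1 + [:0, 1:]) ^ a"
  have "coeff q m = of_nat (a choose m)" for m
  proof (cases "m \<le> a")
    case True
    then show ?thesis by (simp add: q_def one_pCons coeff_linear_poly_power)
  next
    case False
    have "degree ([:1, 1 :: 'a:] ^ a) \<le> a"
      using degree_power_le[of "[:1, 1::'a:]" a] by simp
    then show ?thesis using False by (simp add: q_def one_pCons coeff_eq_0 binomial_eq_0)
  qed
  moreover have "coeff ([:0, 1:] ^ a) n = (if n = a then 1 else 0 :: 'a)"
    by (simp add: monom_altdef[of 1 a, simplified, symmetric])
  ultimately show ?thesis
    unfolding q_def[symmetric] coeff_add by (auto simp: coeff_pCons split: nat.split)
qed

text \<open>
  With $u, v, w$ three consecutive binomial coefficients, the extra $1$ from $x^a$ may fall on any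
  of them. On $u$, the coefficient after $v$ is zero. On $v$, it only helps. On $w$, it must be
  checked that $u(w+1) \le v^2$ for
  $u = {a \choose 3}$, $v = {a \choose 2}$ and $w = a$. Otherwise this is the log-concavity of the rows of
  Pascal's triangle. All cases rest on the ratios $v/u$ and $w/v$, stated as \<open>uv\<close> and \<open>vw\<close> below.
\<close>
lemma caterpillar_factor_log_concave:
  assumes "a \<ge> 1"
  defines "f \<equiv> coeff ([:0, 1:] ^ a + [:0, 1:] * (1 + [:0, 1:]) ^ a :: int poly)"
  shows "f n * f (n + 2) \<le> (f (n + 1))\<^sup>2"
proof (cases n)
  case 0
  then show ?thesis using assms(1) unfolding f_def coeff_caterpillar_factor by simp
next
  case (Suc m)
  define u v w where "u = int (a choose m)" and "v = int (a choose (m + 1))"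
    and "w = int (a choose (m + 2))"
  have nn: "0 \<le> u" "0 \<le> v" "0 \<le> w" by (simp_all add: u_def v_def w_def)
  have f: "f n = u + (if a = m + 1 then 1 else 0)" "f (n + 1) = v + (if a = m + 2 then 1 else 0)"
    "f (n + 2) = w + (if a = m + 3 then 1 else 0)"
    unfolding f_def coeff_caterpillar_factor Suc u_def v_def w_def by auto
  show ?thesis
  proof (cases "a \<le> m + 1")
    case True
    then have "f (n + 2) = 0" unfolding f(3) by (simp add: w_def binomial_eq_0)
    then show ?thesis by simp
  next
    case False
    have absorb: "(int i + 1) * int (a choose (i + 1)) = (int a - int i) * int (a choose i)"
      if "i \<le> a" for i
    proof -
      have "(i + 1) * (a choose (i + 1)) = (a - i) * (a choose i)"
        using binomial_absorb_comp[of a i] binomial_absorption[of i a] by simp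
      then have "int ((i + 1) * (a choose (i + 1))) = int ((a - i) * (a choose i))"
        by (rule arg_cong)
      then show ?thesis using that by (simp add: of_nat_diff algebra_simps)
    qed
    have uv: "(int m + 1) * v = (int a - int m) * u"
      using absorb[of m] False by (simp add: u_def v_def)
    have vw: "(int m + 2) * w = (int a - int m - 1) * v"
      using absorb[of "m + 1"] False by (simp add: v_def w_def algebra_simps)
    consider "a = m + 2" | "a = m + 3" | "a \<ge> m + 4" using False by linarith
    then show ?thesis
    proof cases
      case 1
      then have "w = 1" by (simp add: w_def)
      with vw 1 have v: "v = int m + 2" by simp
      with uv 1 have "2 * u = (v - 1) * v" by (simp add: algebra_simps)
      also have "\<dots> \<le> 2 * (v + 1)\<^sup>2"
        using v by (simp add: power2_eq_square algebra_simps)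
      finally show ?thesis unfolding f using 1 \<open>w = 1\<close> by simp
    next
      case 2
      then have w: "w = int m + 3" by (simp add: w_def numeral_3_eq_3 del: binomial_Suc_Suc)
      with vw 2 have v: "2 * v = (int m + 2) * (int m + 3)" by simp
      from uv 2 have u: "3 * u = (int m + 1) * v" by simp
      have "3 * (u * (w + 1)) = (3 * u) * (int m + 4)"
        by (simp add: w)
      also have "\<dots> = (int m + 1) * (int m + 4) * v"
        unfolding u by simp
      also have "\<dots> \<le> 3 * v * v"
        by (rule mult_right_mono) (use v nn in \<open>auto simp: algebra_simps\<close>)
      finally show ?thesis unfolding f using 2 by (simp add: power2_eq_square)
    next
      case 3
      define b where "b = int a - int m"
      have b: "b \<ge> 4" using 3 by (simp add: b_def)
      have "(b * (int m + 2)) * (u * w) = (b * u) * ((int m + 2) * w)"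
        by (simp add: algebra_simps)
      also have "\<dots> = ((int m + 1) * (b - 1)) * (v * v)"
        unfolding uv[folded b_def, symmetric] vw[folded b_def] by simp
      also have "\<dots> \<le> (b * (int m + 2)) * (v * v)"
        by (rule mult_right_mono) (use b in \<open>auto simp: algebra_simps\<close>)
      finally have "u * w \<le> v * v"
        using b by (simp add: mult_le_cancel_left_pos)
      then show ?thesis unfolding f using 3 by (simp add: power2_eq_square)
    qed
  qed
qed

lemma nonneg_minors2_toeplitz_caterpillar_factor:
  assumes "a \<ge> 1"
  shows "nonneg_minors2 (toeplitz ([:0, 1:] ^ a + [:0, 1:] * (1 + [:0, 1:]) ^ a :: int poly))"
    (is "nonneg_minors2 (toeplitz ?p)")
proof (rule nonneg_minors2_toeplitz_if_log_concave)
  have support: "coeff ?p n \<noteq> 0 \<longleftrightarrow> 1 \<le> n \<and> n \<le> a + 1" for n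
    unfolding coeff_caterpillar_factor using assms by (auto split: nat.split)
  show "0 \<le> coeff ?p n" for n
    unfolding coeff_caterpillar_factor by (simp split: nat.split)
  show "coeff ?p m \<noteq> 0" if "l < m" "m < n" "coeff ?p l \<noteq> 0" "coeff ?p n \<noteq> 0" for l m n
    using that unfolding support by simp
  show "coeff ?p n * coeff ?p (n + 2) \<le> (coeff ?p (n + 1))\<^sup>2" for n
    by (rule caterpillar_factor_log_concave[OF assms])
qed

theorem theorem3p3:
  fixes k :: nat and a :: "nat \<Rightarrow> nat"
  assumes "k \<ge> 1"
    and "\<forall>i\<in>{1..k}. a i \<ge> 1"
  shows "domination_poly (caterpillar k a) =
           (\<Prod>i=1..k. [:0, 1:] ^ a i + [:0, 1:] * (1 + [:0, 1:]) ^ a i) \<and>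
         (\<forall>j\<ge>1. (num_dominating_sets (caterpillar k a) j)\<^sup>2 \<ge>
           num_dominating_sets (caterpillar k a) (j - 1) *
           num_dominating_sets (caterpillar k a) (j + 1))"
proof (intro conjI allI impI)
  let ?D = "domination_poly (caterpillar k a)" and ?d = "num_dominating_sets (caterpillar k a)"
  show product: "?D = (\<Prod>i=1..k. [:0, 1:] ^ a i + [:0, 1:] * (1 + [:0, 1:]) ^ a i)"
    by (rule domination_poly_caterpillar[OF assms(2)])
  fix j :: nat
  assume j: "j \<ge> 1"
  have "nonneg_minors2 (toeplitz ?D)"
    unfolding product
    by (rule nonneg_minors2_toeplitz_prod, rule nonneg_minors2_toeplitz_caterpillar_factor)
      (use assms(2) in auto)
  from log_concave_if_nonneg_minors2_toeplitz[OF this, of "j - 1"]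
  have "coeff ?D (j - 1) * coeff ?D (j + 1) \<le> (coeff ?D j)\<^sup>2"
    using j by (simp add: eval_nat_numeral)
  moreover have "coeff ?D i = int (?d i)" for i
    by (rule coeff_domination_poly) (simp add: caterpillar_def finite_caterpillar_verts)
  ultimately have "int (?d (j - 1) * ?d (j + 1)) \<le> int ((?d j)\<^sup>2)"
    by simp
  then show "?d (j - 1) * ?d (j + 1) \<le> (?d j)\<^sup>2"
    by (simp only: of_nat_le_iff)
qed

end
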